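(* Assume that Peano arithmetic (PA) is consistent and $\omega$-consistent. Let $\mathbf{P}(x)$ be a formula in the language of PA with exactly one free variable $x$ such that $$\vdash \mathbf{P}(x) \longleftrightarrow \exists z\, Prov(\ulcorner \neg \mathbf{P}(\dot z) \urcorner)$$ (such a formula exists by the generalized diagonal lemma). Then for every natural number $k$, the sentence $\mathbf{P}(\overline{k})$ is undecidable in PA.
   Context: PA is first-order Peano arithmetic in the language with constant symbol $0$, unary function symbol $S$ and binary function symbols $+,\times$. $\vdash\varphi$ means that $\varphi$ is provable in PA; $\varphi$ is refutable if $\vdash\neg\varphi$; a formula is undecidable if it is neither provable nor refutable. $\overline{k}$ is the numeral of $k$. PA is consistent if there is no formula $\varphi$ with both $\vdash\varphi$ and $\vdash\neg\varphi$. PA is $\omega$-consistent if there is no formula $\varphi(x)$ such that $\vdash\exists x\,\varphi(x)$ and $\vdash\neg\varphi(\overline{n})$ for every natural number $n$. $\ulcorner\varphi\urcorner$ is the Gödel number of $\varphi$ (or its numeral) under a fixed standard arithmetization of syntax. $Prov(x)$ is the standard $\Sigma_1$ provability predicate of PA ("there exists a code of a PA-proof of the formula with Gödel number $x$"). For a formula $\psi(x)$ with one free variable $x$, $Prov(\ulcorner\neg\psi(\dot z)\urcorner)$ denotes the formula with free variable $z$ stating that $Prov$ holds of the Gödel number of the negation of the sentence obtained from $\psi(x)$ by substituting the numeral of $z$ for $x$ (expressed via arithmetized negation and substitution functions). *)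

theory Defs
  imports Main
begin

section \<open>Syntax of the language of arithmetic\<close>

text \<open>
  Terms and formulas over \<open>0, S, +, \<times>\<close> with de Bruijn indices: below \<open>n\<close> quantifiers,
  \<open>Var (n + i)\<close> denotes the free variable number \<open>i\<close>.
\<close>

datatype trm =
    Var nat
  | Zero
  | Succ trm
  | Add trm trm
  | Mult trm trm

datatype fm =
    Eq trm trm  (infix \<open>\<^bold>=\<close> 56)
  | Neg fm
  | Imp fm fm  (infixr \<open>\<^bold>\<longrightarrow>\<close> 52)
  | Forall fm

definition Conj :: "fm \<Rightarrow> fm \<Rightarrow> fm"  (infixr \<open>\<^bold>\<and>\<close> 54)
  where "p \<^bold>\<and> q = Neg (p \<^bold>\<longrightarrow> Neg q)"

definition Disj :: "fm \<Rightarrow> fm \<Rightarrow> fm"  (infixr \<open>\<^bold>\<or>\<close> 53)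
  where "p \<^bold>\<or> q = (Neg p \<^bold>\<longrightarrow> q)"

definition Iff :: "fm \<Rightarrow> fm \<Rightarrow> fm"  (infix \<open>\<^bold>\<longleftrightarrow>\<close> 51)
  where "(p \<^bold>\<longleftrightarrow> q) = ((p \<^bold>\<longrightarrow> q) \<^bold>\<and> (q \<^bold>\<longrightarrow> p))"

definition Exists :: "fm \<Rightarrow> fm"
  where "Exists p = Neg (Forall (Neg p))"

primrec fv_trm :: "trm \<Rightarrow> nat set" where
  "fv_trm (Var n) = {n}"
| "fv_trm Zero = {}"
| "fv_trm (Succ t) = fv_trm t"
| "fv_trm (Add t u) = fv_trm t \<union> fv_trm u"
| "fv_trm (Mult t u) = fv_trm t \<union> fv_trm u"

primrec fv :: "fm \<Rightarrow> nat set" where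
  "fv (t \<^bold>= u) = fv_trm t \<union> fv_trm u"
| "fv (Neg p) = fv p"
| "fv (p \<^bold>\<longrightarrow> q) = fv p \<union> fv q"
| "fv (Forall p) = {n. Suc n \<in> fv p}"

text \<open>\<open>lift k\<close> increments all variables from number \<open>k\<close> on.\<close>

primrec lift_trm :: "nat \<Rightarrow> trm \<Rightarrow> trm" where
  "lift_trm k (Var n) = Var (if n < k then n else Suc n)"
| "lift_trm k Zero = Zero"
| "lift_trm k (Succ t) = Succ (lift_trm k t)"
| "lift_trm k (Add t u) = Add (lift_trm k t) (lift_trm k u)"
| "lift_trm k (Mult t u) = Mult (lift_trm k t) (lift_trm k u)"

primrec lift :: "nat \<Rightarrow> fm \<Rightarrow> fm" where
  "lift k (t \<^bold>= u) = (lift_trm k t \<^bold>= lift_trm k u)"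
| "lift k (Neg p) = Neg (lift k p)"
| "lift k (p \<^bold>\<longrightarrow> q) = (lift k p \<^bold>\<longrightarrow> lift k q)"
| "lift k (Forall p) = Forall (lift (Suc k) p)"

abbreviation up :: "trm \<Rightarrow> trm"  (\<open>_\<up>\<close> [1000] 1000)
  where "t\<up> \<equiv> lift_trm 0 t"

text \<open>
  \<open>subst k s\<close> replaces variable \<open>k\<close> by \<open>s\<close> and decrements the variables above \<open>k\<close>,
  whose binder is thereby removed.
\<close>

primrec subst_trm :: "nat \<Rightarrow> trm \<Rightarrow> trm \<Rightarrow> trm" where
  "subst_trm k s (Var n) = (if n < k then Var n else if n = k then s else Var (n - 1))"
| "subst_trm k s Zero = Zero"
| "subst_trm k s (Succ t) = Succ (subst_trm k s t)"
| "subst_trm k s (Add t u) = Add (subst_trm k s t) (subst_trm k s u)"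
| "subst_trm k s (Mult t u) = Mult (subst_trm k s t) (subst_trm k s u)"

primrec subst :: "nat \<Rightarrow> trm \<Rightarrow> fm \<Rightarrow> fm" where
  "subst k s (t \<^bold>= u) = (subst_trm k s t \<^bold>= subst_trm k s u)"
| "subst k s (Neg p) = Neg (subst k s p)"
| "subst k s (p \<^bold>\<longrightarrow> q) = (subst k s p \<^bold>\<longrightarrow> subst k s q)"
| "subst k s (Forall p) = Forall (subst (Suc k) (s\<up>) p)"

primrec num :: "nat \<Rightarrow> trm" where
  "num 0 = Zero"
| "num (Suc n) = Succ (num n)"


section \<open>Peano arithmetic\<close>

definition equality_axioms :: "fm list" where
  "equality_axioms =
    [Var 0 \<^bold>= Var 0,
     Var 0 \<^bold>= Var 1 \<^bold>\<longrightarrow> Var 0 \<^bold>= Var 2 \<^bold>\<longrightarrow> Var 1 \<^bold>= Var 2,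
     Var 0 \<^bold>= Var 1 \<^bold>\<longrightarrow> Succ (Var 0) \<^bold>= Succ (Var 1),
     Var 0 \<^bold>= Var 1 \<^bold>\<longrightarrow> Var 2 \<^bold>= Var 3 \<^bold>\<longrightarrow> Add (Var 0) (Var 2) \<^bold>= Add (Var 1) (Var 3),
     Var 0 \<^bold>= Var 1 \<^bold>\<longrightarrow> Var 2 \<^bold>= Var 3 \<^bold>\<longrightarrow> Mult (Var 0) (Var 2) \<^bold>= Mult (Var 1) (Var 3)]"

definition arithmetic_axioms :: "fm list" where
  "arithmetic_axioms =
    [Neg (Zero \<^bold>= Succ (Var 0)),
     Succ (Var 0) \<^bold>= Succ (Var 1) \<^bold>\<longrightarrow> Var 0 \<^bold>= Var 1,
     Add (Var 0) Zero \<^bold>= Var 0,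
     Add (Var 0) (Succ (Var 1)) \<^bold>= Succ (Add (Var 0) (Var 1)),
     Mult (Var 0) Zero \<^bold>= Zero,
     Mult (Var 0) (Succ (Var 1)) \<^bold>= Add (Mult (Var 0) (Var 1)) (Var 0)]"

text \<open>
  In \<open>Induction\<close>, lifting from 1 on makes room for the variable \<open>x\<close> of \<open>S x\<close>, so that
  the substitution instance is \<open>p(S x)\<close> under the same quantifier as \<open>p(x)\<close>.
\<close>

inductive axiom :: "fm \<Rightarrow> bool" where
  K: "axiom (p \<^bold>\<longrightarrow> q \<^bold>\<longrightarrow> p)"
| S: "axiom ((p \<^bold>\<longrightarrow> q \<^bold>\<longrightarrow> r) \<^bold>\<longrightarrow> (p \<^bold>\<longrightarrow> q) \<^bold>\<longrightarrow> p \<^bold>\<longrightarrow> r)"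
| Contrapos: "axiom ((Neg p \<^bold>\<longrightarrow> Neg q) \<^bold>\<longrightarrow> q \<^bold>\<longrightarrow> p)"
| Instance: "axiom (Forall p \<^bold>\<longrightarrow> subst 0 t p)"
| Distrib: "axiom (Forall (lift 0 p \<^bold>\<longrightarrow> q) \<^bold>\<longrightarrow> p \<^bold>\<longrightarrow> Forall q)"
| Equality: "p \<in> set equality_axioms \<Longrightarrow> axiom p"
| Arithmetic: "p \<in> set arithmetic_axioms \<Longrightarrow> axiom p"
| Induction: "axiom (subst 0 Zero p \<^bold>\<longrightarrow>
    Forall (p \<^bold>\<longrightarrow> subst 0 (Succ (Var 0)) (lift 1 p)) \<^bold>\<longrightarrow> Forall p)"

inductive provable :: "fm \<Rightarrow> bool"  (\<open>\<turnstile> _\<close> [51] 50) where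
  Axiom: "axiom p \<Longrightarrow> \<turnstile> p"
| ModusPonens: "\<turnstile> p \<^bold>\<longrightarrow> q \<Longrightarrow> \<turnstile> p \<Longrightarrow> \<turnstile> q"
| Generalization: "\<turnstile> p \<Longrightarrow> \<turnstile> Forall p"

definition refutable :: "fm \<Rightarrow> bool"
  where "refutable p \<longleftrightarrow> \<turnstile> Neg p"

definition undecidable :: "fm \<Rightarrow> bool"
  where "undecidable p \<longleftrightarrow> \<not> \<turnstile> p \<and> \<not> refutable p"

definition PA_consistent :: bool
  where "PA_consistent \<longleftrightarrow> \<not> (\<exists>p. \<turnstile> p \<and> \<turnstile> Neg p)"

definition PA_omega_consistent :: bool where
  "PA_omega_consistent \<longleftrightarrow>
    \<not> (\<exists>p. fv p \<subseteq> {0} \<and> \<turnstile> Exists p \<and> (\<forall>n. \<turnstile> Neg (subst 0 (num n) p)))"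


section \<open>Goedel numbers\<close>

text \<open>
  The map \<open>(x, y) \<mapsto> (x + y)\<^sup>2 + x\<close> is injective and given by a term of the language.
  Hence the constructors of syntax act on Goedel numbers by terms of the language.
\<close>

definition npair :: "nat \<Rightarrow> nat \<Rightarrow> nat"
  where "npair x y = (x + y) * (x + y) + x"

primrec gn_trm :: "trm \<Rightarrow> nat" where
  "gn_trm (Var n) = npair 0 n"
| "gn_trm Zero = npair 1 0"
| "gn_trm (Succ t) = npair 2 (gn_trm t)"
| "gn_trm (Add t u) = npair 3 (npair (gn_trm t) (gn_trm u))"
| "gn_trm (Mult t u) = npair 4 (npair (gn_trm t) (gn_trm u))"

primrec gn :: "fm \<Rightarrow> nat" where
  "gn (t \<^bold>= u) = npair 5 (npair (gn_trm t) (gn_trm u))"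
| "gn (Neg p) = npair 6 (gn p)"
| "gn (p \<^bold>\<longrightarrow> q) = npair 7 (npair (gn p) (gn q))"
| "gn (Forall p) = npair 8 (gn p)"

definition tpair :: "trm \<Rightarrow> trm \<Rightarrow> trm"  (\<open>\<langle>_, _\<rangle>\<close>)
  where "\<langle>s, t\<rangle> = Add (Mult (Add s t) (Add s t)) s"

definition cVar :: "trm \<Rightarrow> trm" where "cVar n = \<langle>num 0, n\<rangle>"
definition cZero :: trm where "cZero = \<langle>num 1, num 0\<rangle>"
definition cSucc :: "trm \<Rightarrow> trm" where "cSucc t = \<langle>num 2, t\<rangle>"
definition cAdd :: "trm \<Rightarrow> trm \<Rightarrow> trm" where "cAdd t u = \<langle>num 3, \<langle>t, u\<rangle>\<rangle>"
definition cMult :: "trm \<Rightarrow> trm \<Rightarrow> trm" where "cMult t u = \<langle>num 4, \<langle>t, u\<rangle>\<rangle>"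
definition cEq :: "trm \<Rightarrow> trm \<Rightarrow> trm" where "cEq t u = \<langle>num 5, \<langle>t, u\<rangle>\<rangle>"
definition cNeg :: "trm \<Rightarrow> trm" where "cNeg p = \<langle>num 6, p\<rangle>"
definition cImp :: "trm \<Rightarrow> trm \<Rightarrow> trm" where "cImp p q = \<langle>num 7, \<langle>p, q\<rangle>\<rangle>"
definition cForall :: "trm \<Rightarrow> trm" where "cForall p = \<langle>num 8, p\<rangle>"


section \<open>Arithmetized derivations\<close>

text \<open>
  The functions below build formulas of the language from terms. A term that is moved under
  \<open>n\<close> quantifiers is lifted \<open>n\<close> times, and the variables of the quantifiers themselves are
  then \<open>Var 0\<close>, ..., \<open>Var (n - 1)\<close>, the innermost one being \<open>Var 0\<close>.
\<close>

definition Le :: "trm \<Rightarrow> trm \<Rightarrow> fm"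
  where "Le t u = Exists (Add (t\<up>) (Var 0) \<^bold>= u\<up>)"

definition Less :: "trm \<Rightarrow> trm \<Rightarrow> fm"
  where "Less t u = Le (Succ t) u"

definition ExLe :: "trm \<Rightarrow> fm \<Rightarrow> fm"
  where "ExLe t p = Exists (Le (Var 0) (t\<up>) \<^bold>\<and> p)"

definition ExLess :: "trm \<Rightarrow> fm \<Rightarrow> fm"
  where "ExLess t p = Exists (Less (Var 0) (t\<up>) \<^bold>\<and> p)"

definition AllLe :: "trm \<Rightarrow> fm \<Rightarrow> fm"
  where "AllLe t p = Forall (Le (Var 0) (t\<up>) \<^bold>\<longrightarrow> p)"

text \<open>\<open>n\<close> nested quantifiers bounded by the same term\<close>

primrec ExsLe :: "nat \<Rightarrow> trm \<Rightarrow> fm \<Rightarrow> fm" where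
  "ExsLe 0 t p = p"
| "ExsLe (Suc n) t p = ExLe t (ExsLe n (t\<up>) p)"

text \<open>
  Goedel's beta function: entry \<open>i\<close> of the sequence coded by \<open>s = \<langle>a, b\<rangle>\<close> is
  \<open>v = a mod (1 + (1 + i) * b)\<close>.
\<close>

definition Nth :: "trm \<Rightarrow> trm \<Rightarrow> trm \<Rightarrow> fm" where
  "Nth s i v = ExsLe 3 s (
    s\<up>\<up>\<up> \<^bold>= \<langle>Var 2, Var 1\<rangle> \<^bold>\<and>
    Var 2 \<^bold>= Add (Mult (Var 0) (Succ (Mult (Succ (i\<up>\<up>\<up>)) (Var 1)))) (v\<up>\<up>\<up>) \<^bold>\<and>
    Le (v\<up>\<up>\<up>) (Mult (Succ (i\<up>\<up>\<up>)) (Var 1)))"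

definition Earlier :: "trm \<Rightarrow> trm \<Rightarrow> trm \<Rightarrow> fm"
  where "Earlier s i v = ExLess i (Nth (s\<up>) (Var 0) (v\<up>))"

text \<open>
  Every inductively defined relation is arithmetized by derivations, i.e. sequences each
  of whose entries results from earlier entries by one of the rules. The rules are given by
  a formula \<open>step w s i v\<close>: \<open>v\<close> follows by some rule from entries of \<open>s\<close> before \<open>i\<close>.

  The term \<open>w\<close> is a common bound for all existential witnesses. In the provability
  predicate, \<open>w\<close> is a component of the code of a proof. This makes that predicate
  \<open>\<Sigma>\<^sub>1\<close> in the strict sense: one unbounded existential quantifier followed by
  a formula with bounded quantifiers only.
\<close>

type_synonym rules = "trm \<Rightarrow> trm \<Rightarrow> trm \<Rightarrow> trm \<Rightarrow> fm"

definition Derivation :: "rules \<Rightarrow> trm \<Rightarrow> trm \<Rightarrow> trm \<Rightarrow> trm \<Rightarrow> fm" where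
  "Derivation step w s n x =
    Nth s n x \<^bold>\<and>
    AllLe n (ExLe (w\<up>) (
      Nth (s\<up>\<up>) (Var 1) (Var 0) \<^bold>\<and> step (w\<up>\<up>) (s\<up>\<up>) (Var 1) (Var 0)))"

definition Derivable :: "rules \<Rightarrow> trm \<Rightarrow> trm \<Rightarrow> fm" where
  "Derivable step w x = ExsLe 2 w (Derivation step (w\<up>\<up>) (Var 1) (Var 0) (x\<up>\<up>))"


section \<open>Arithmetized syntax\<close>

definition term_step :: rules where
  "term_step w s i v =
    (ExsLe 1 w (v\<up> \<^bold>= cVar (Var 0)) \<^bold>\<or>
     v \<^bold>= cZero \<^bold>\<or>
     ExsLe 1 w (Earlier (s\<up>) (i\<up>) (Var 0) \<^bold>\<and> v\<up> \<^bold>= cSucc (Var 0)) \<^bold>\<or>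
     ExsLe 2 w (
       Earlier (s\<up>\<up>) (i\<up>\<up>) (Var 1) \<^bold>\<and> Earlier (s\<up>\<up>) (i\<up>\<up>) (Var 0) \<^bold>\<and>
       (v\<up>\<up> \<^bold>= cAdd (Var 1) (Var 0) \<^bold>\<or> v\<up>\<up> \<^bold>= cMult (Var 1) (Var 0))))"

definition IsTerm :: "trm \<Rightarrow> trm \<Rightarrow> fm"
  where "IsTerm w x = Derivable term_step w x"

definition form_step :: rules where
  "form_step w s i v =
    (ExsLe 2 w (
       IsTerm (w\<up>\<up>) (Var 1) \<^bold>\<and> IsTerm (w\<up>\<up>) (Var 0) \<^bold>\<and> v\<up>\<up> \<^bold>= cEq (Var 1) (Var 0)) \<^bold>\<or>
     ExsLe 1 w (
       Earlier (s\<up>) (i\<up>) (Var 0) \<^bold>\<and> (v\<up> \<^bold>= cNeg (Var 0) \<^bold>\<or> v\<up> \<^bold>= cForall (Var 0))) \<^bold>\<or>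
     ExsLe 2 w (
       Earlier (s\<up>\<up>) (i\<up>\<up>) (Var 1) \<^bold>\<and> Earlier (s\<up>\<up>) (i\<up>\<up>) (Var 0) \<^bold>\<and>
       v\<up>\<up> \<^bold>= cImp (Var 1) (Var 0)))"

definition IsForm :: "trm \<Rightarrow> trm \<Rightarrow> fm"
  where "IsForm w x = Derivable form_step w x"

text \<open>
  The triples \<open>\<langle>k, \<langle>x, y\<rangle>\<rangle>\<close> such that \<open>y\<close> codes the result of lifting the term or formula
  coded by \<open>x\<close> from \<open>k\<close> on
\<close>

definition lift_step :: rules where
  "lift_step w s i v =
    (ExsLe 2 w (
       let k = Var 1; n = Var 0; v = v\<up>\<up> in
       Less n k \<^bold>\<and> v \<^bold>= \<langle>k, \<langle>cVar n, cVar n\<rangle>\<rangle> \<^bold>\<or>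
       Le k n \<^bold>\<and> v \<^bold>= \<langle>k, \<langle>cVar n, cVar (Succ n)\<rangle>\<rangle>) \<^bold>\<or>
     ExsLe 1 w (
       let k = Var 0; v = v\<up> in
       v \<^bold>= \<langle>k, \<langle>cZero, cZero\<rangle>\<rangle>) \<^bold>\<or>
     ExsLe 3 w (
       let k = Var 2; x = Var 1; y = Var 0; s = s\<up>\<up>\<up>; i = i\<up>\<up>\<up>; v = v\<up>\<up>\<up> in
       Earlier s i \<langle>k, \<langle>x, y\<rangle>\<rangle> \<^bold>\<and>
         (v \<^bold>= \<langle>k, \<langle>cSucc x, cSucc y\<rangle>\<rangle> \<^bold>\<or> v \<^bold>= \<langle>k, \<langle>cNeg x, cNeg y\<rangle>\<rangle>) \<^bold>\<or>
       Earlier s i \<langle>Succ k, \<langle>x, y\<rangle>\<rangle> \<^bold>\<and> v \<^bold>= \<langle>k, \<langle>cForall x, cForall y\<rangle>\<rangle>) \<^bold>\<or>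
     ExsLe 5 w (
       let k = Var 4; x = Var 3; y = Var 2; x' = Var 1; y' = Var 0;
           s = s\<up>\<up>\<up>\<up>\<up>; i = i\<up>\<up>\<up>\<up>\<up>; v = v\<up>\<up>\<up>\<up>\<up> in
       Earlier s i \<langle>k, \<langle>x, y\<rangle>\<rangle> \<^bold>\<and> Earlier s i \<langle>k, \<langle>x', y'\<rangle>\<rangle> \<^bold>\<and>
       (v \<^bold>= \<langle>k, \<langle>cAdd x x', cAdd y y'\<rangle>\<rangle> \<^bold>\<or> v \<^bold>= \<langle>k, \<langle>cMult x x', cMult y y'\<rangle>\<rangle> \<^bold>\<or>
        v \<^bold>= \<langle>k, \<langle>cEq x x', cEq y y'\<rangle>\<rangle> \<^bold>\<or> v \<^bold>= \<langle>k, \<langle>cImp x x', cImp y y'\<rangle>\<rangle>)))"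

definition IsLift :: "trm \<Rightarrow> trm \<Rightarrow> trm \<Rightarrow> trm \<Rightarrow> fm"
  where "IsLift w k x y = Derivable lift_step w \<langle>k, \<langle>x, y\<rangle>\<rangle>"

text \<open>
  The quadruples \<open>\<langle>k, \<langle>t, \<langle>x, y\<rangle>\<rangle>\<rangle>\<close> such that \<open>y\<close> codes the result of substituting the term
  coded by \<open>t\<close> for variable \<open>k\<close> in the term or formula coded by \<open>x\<close>
\<close>

definition subst_step :: rules where
  "subst_step w s i v =
    (ExsLe 3 w (
       let k = Var 2; t = Var 1; n = Var 0; v = v\<up>\<up>\<up> in
       Less n k \<^bold>\<and> v \<^bold>= \<langle>k, \<langle>t, \<langle>cVar n, cVar n\<rangle>\<rangle>\<rangle> \<^bold>\<or>
       n \<^bold>= k \<^bold>\<and> v \<^bold>= \<langle>k, \<langle>t, \<langle>cVar n, t\<rangle>\<rangle>\<rangle> \<^bold>\<or>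
       Le k n \<^bold>\<and> v \<^bold>= \<langle>k, \<langle>t, \<langle>cVar (Succ n), cVar n\<rangle>\<rangle>\<rangle>) \<^bold>\<or>
     ExsLe 2 w (
       let k = Var 1; t = Var 0; v = v\<up>\<up> in
       v \<^bold>= \<langle>k, \<langle>t, \<langle>cZero, cZero\<rangle>\<rangle>\<rangle>) \<^bold>\<or>
     ExsLe 4 w (
       let k = Var 3; t = Var 2; x = Var 1; y = Var 0;
           s = s\<up>\<up>\<up>\<up>; i = i\<up>\<up>\<up>\<up>; v = v\<up>\<up>\<up>\<up> in
       Earlier s i \<langle>k, \<langle>t, \<langle>x, y\<rangle>\<rangle>\<rangle> \<^bold>\<and>
       (v \<^bold>= \<langle>k, \<langle>t, \<langle>cSucc x, cSucc y\<rangle>\<rangle>\<rangle> \<^bold>\<or> v \<^bold>= \<langle>k, \<langle>t, \<langle>cNeg x, cNeg y\<rangle>\<rangle>\<rangle>)) \<^bold>\<or>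
     ExsLe 5 w (
       let k = Var 4; t = Var 3; t' = Var 2; x = Var 1; y = Var 0;
           w = w\<up>\<up>\<up>\<up>\<up>; s = s\<up>\<up>\<up>\<up>\<up>; i = i\<up>\<up>\<up>\<up>\<up>; v = v\<up>\<up>\<up>\<up>\<up> in
       IsLift w Zero t t' \<^bold>\<and> Earlier s i \<langle>Succ k, \<langle>t', \<langle>x, y\<rangle>\<rangle>\<rangle> \<^bold>\<and>
       v \<^bold>= \<langle>k, \<langle>t, \<langle>cForall x, cForall y\<rangle>\<rangle>\<rangle>) \<^bold>\<or>
     ExsLe 6 w (
       let k = Var 5; t = Var 4; x = Var 3; y = Var 2; x' = Var 1; y' = Var 0;
           s = s\<up>\<up>\<up>\<up>\<up>\<up>; i = i\<up>\<up>\<up>\<up>\<up>\<up>; v = v\<up>\<up>\<up>\<up>\<up>\<up> in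
       Earlier s i \<langle>k, \<langle>t, \<langle>x, y\<rangle>\<rangle>\<rangle> \<^bold>\<and> Earlier s i \<langle>k, \<langle>t, \<langle>x', y'\<rangle>\<rangle>\<rangle> \<^bold>\<and>
       (v \<^bold>= \<langle>k, \<langle>t, \<langle>cAdd x x', cAdd y y'\<rangle>\<rangle>\<rangle> \<^bold>\<or> v \<^bold>= \<langle>k, \<langle>t, \<langle>cMult x x', cMult y y'\<rangle>\<rangle>\<rangle> \<^bold>\<or>
        v \<^bold>= \<langle>k, \<langle>t, \<langle>cEq x x', cEq y y'\<rangle>\<rangle>\<rangle> \<^bold>\<or> v \<^bold>= \<langle>k, \<langle>t, \<langle>cImp x x', cImp y y'\<rangle>\<rangle>\<rangle>)))"

definition IsSubst :: "trm \<Rightarrow> trm \<Rightarrow> trm \<Rightarrow> trm \<Rightarrow> trm \<Rightarrow> fm"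
  where "IsSubst w k t x y = Derivable subst_step w \<langle>k, \<langle>t, \<langle>x, y\<rangle>\<rangle>\<rangle>"

text \<open>The pairs \<open>\<langle>n, y\<rangle>\<close> such that \<open>y\<close> codes the numeral of \<open>n\<close>\<close>

definition num_step :: rules where
  "num_step w s i v =
    (v \<^bold>= \<langle>Zero, cZero\<rangle> \<^bold>\<or>
     ExsLe 2 w (
       Earlier (s\<up>\<up>) (i\<up>\<up>) \<langle>Var 1, Var 0\<rangle> \<^bold>\<and> v\<up>\<up> \<^bold>= \<langle>Succ (Var 1), cSucc (Var 0)\<rangle>))"

definition IsNum :: "trm \<Rightarrow> trm \<Rightarrow> trm \<Rightarrow> fm"
  where "IsNum w n y = Derivable num_step w \<langle>n, y\<rangle>"


section \<open>Arithmetized provability\<close>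

primrec IsOneOf :: "fm list \<Rightarrow> trm \<Rightarrow> fm" where
  "IsOneOf [] v = Neg (Zero \<^bold>= Zero)"
| "IsOneOf (p # ps) v = (v \<^bold>= num (gn p) \<^bold>\<or> IsOneOf ps v)"

definition IsAxiom :: "trm \<Rightarrow> trm \<Rightarrow> fm" where
  "IsAxiom w v =
    (ExsLe 2 w (
       let p = Var 1; q = Var 0; w = w\<up>\<up>; v = v\<up>\<up> in
       IsForm w p \<^bold>\<and> IsForm w q \<^bold>\<and>
       (v \<^bold>= cImp p (cImp q p) \<^bold>\<or>
        v \<^bold>= cImp (cImp (cNeg p) (cNeg q)) (cImp q p))) \<^bold>\<or>
     ExsLe 3 w (
       let p = Var 2; q = Var 1; r = Var 0; w = w\<up>\<up>\<up>; v = v\<up>\<up>\<up> in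
       IsForm w p \<^bold>\<and> IsForm w q \<^bold>\<and> IsForm w r \<^bold>\<and>
       v \<^bold>= cImp (cImp p (cImp q r)) (cImp (cImp p q) (cImp p r))) \<^bold>\<or>
     ExsLe 3 w (
       let p = Var 2; t = Var 1; q = Var 0; w = w\<up>\<up>\<up>; v = v\<up>\<up>\<up> in
       IsForm w p \<^bold>\<and> IsTerm w t \<^bold>\<and> IsSubst w Zero t p q \<^bold>\<and>
       v \<^bold>= cImp (cForall p) q) \<^bold>\<or>
     ExsLe 3 w (
       let p = Var 2; q = Var 1; r = Var 0; w = w\<up>\<up>\<up>; v = v\<up>\<up>\<up> in
       IsForm w p \<^bold>\<and> IsForm w q \<^bold>\<and> IsLift w Zero p r \<^bold>\<and>
       v \<^bold>= cImp (cForall (cImp r q)) (cImp p (cForall q))) \<^bold>\<or>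
     IsOneOf equality_axioms v \<^bold>\<or>
     IsOneOf arithmetic_axioms v \<^bold>\<or>
     ExsLe 4 w (
       let p = Var 3; p0 = Var 2; q = Var 1; pS = Var 0; w = w\<up>\<up>\<up>\<up>; v = v\<up>\<up>\<up>\<up> in
       IsForm w p \<^bold>\<and> IsSubst w Zero cZero p p0 \<^bold>\<and>
       IsLift w (num 1) p q \<^bold>\<and> IsSubst w Zero (cSucc (cVar Zero)) q pS \<^bold>\<and>
       v \<^bold>= cImp p0 (cImp (cForall (cImp p pS)) (cForall p))))"

definition proof_step :: rules where
  "proof_step w s i v =
    (IsAxiom w v \<^bold>\<or>
     ExsLe 1 w (
       Earlier (s\<up>) (i\<up>) (cImp (Var 0) (v\<up>)) \<^bold>\<and> Earlier (s\<up>) (i\<up>) (Var 0)) \<^bold>\<or>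
     ExsLe 1 w (
       Earlier (s\<up>) (i\<up>) (Var 0) \<^bold>\<and> v\<up> \<^bold>= cForall (Var 0)))"

text \<open>
  A code \<open>y = \<langle>w, \<langle>s, n\<rangle>\<rangle>\<close> of a proof of the formula with number \<open>x\<close> consists of the
  sequence \<open>s\<close> of the lines, the number \<open>n\<close> of the last line, and a bound \<open>w\<close> for the
  computations that check the lines.
\<close>

definition Prf :: "trm \<Rightarrow> trm \<Rightarrow> fm" where
  "Prf y x = ExsLe 3 y (
    y\<up>\<up>\<up> \<^bold>= \<langle>Var 2, \<langle>Var 1, Var 0\<rangle>\<rangle> \<^bold>\<and>
    Derivation proof_step (Var 2) (Var 1) (Var 0) (x\<up>\<up>\<up>))"

definition Prov :: "trm \<Rightarrow> fm"
  where "Prov x = Exists (Prf (Var 0) (x\<up>))"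

text \<open>
  Provability of \<open>\<not> p(z)\<close> with the numeral of \<open>z\<close> for the free variable of \<open>p\<close>. The
  quantified variables are, from the outside: a bound for the computations, the code of the
  numeral of \<open>z\<close>, and the code of the substitution instance of \<open>p\<close>.
\<close>

definition ProvNegDot :: "fm \<Rightarrow> trm \<Rightarrow> fm" where
  "ProvNegDot p z = Exists (Exists (Exists (
    IsNum (Var 2) (z\<up>\<up>\<up>) (Var 1) \<^bold>\<and>
    IsSubst (Var 2) Zero (Var 1) (num (gn p)) (Var 0) \<^bold>\<and>
    Prov (cNeg (Var 0)))))"

end

theory Submission
  imports Defs "HOL-Number_Theory.Cong"
begin

text \<open>
  The standard model satisfies every theorem of PA, and in it the arithmetized predicates mean
  what they are meant to. Hence, for every \<open>k\<close>, \<open>P(k)\<close> is true if and only if some \<open>\<not> P(n)\<close> is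
  provable. A provable \<open>\<not> P(n)\<close> would thus be both true, being provable, and false; so no
  \<open>\<not> P(n)\<close> is provable. Then every \<open>P(k)\<close> is false, and therefore not provable either.
\<close>

section \<open>The standard model\<close>

text \<open>Semantically, binding, \<open>lift\<close> and \<open>subst\<close> all amount to
  inserting one value into an environment and shifting the variables above it.\<close>

definition ins :: "nat \<Rightarrow> nat \<Rightarrow> (nat \<Rightarrow> nat) \<Rightarrow> nat \<Rightarrow> nat" where
  "ins k x e = (\<lambda>n. if n < k then e n else if n = k then x else e (n - 1))"

primrec ev :: "(nat \<Rightarrow> nat) \<Rightarrow> trm \<Rightarrow> nat" where
  "ev e (Var n) = e n"
| "ev e Zero = 0"
| "ev e (Succ t) = Suc (ev e t)"
| "ev e (Add t u) = ev e t + ev e u"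
| "ev e (Mult t u) = ev e t * ev e u"

primrec sat :: "(nat \<Rightarrow> nat) \<Rightarrow> fm \<Rightarrow> bool" where
  "sat e (t \<^bold>= u) = (ev e t = ev e u)"
| "sat e (Neg p) = (\<not> sat e p)"
| "sat e (p \<^bold>\<longrightarrow> q) = (sat e p \<longrightarrow> sat e q)"
| "sat e (Forall p) = (\<forall>x. sat (ins 0 x e) p)"

lemma ins_0 [simp]:
  "ins 0 x e 0 = x" "ins 0 x e (Suc n) = e n"
  "ins 0 x e (numeral m) = e (pred_numeral m)"
  by (simp_all add: ins_def numeral_eq_Suc)

lemma ins_ins: "ins 0 x (ins k y e) = ins (Suc k) y (ins 0 x e)"
  by (auto simp: ins_def fun_eq_iff)

lemma ev_lift_ins: "ev (ins k x e) (lift_trm k t) = ev e t"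
  by (induction t) (auto simp: ins_def)

lemma ev_up [simp]: "ev (ins 0 x e) (t\<up>) = ev e t"
  by (rule ev_lift_ins)

lemma sat_lift: "sat (ins k x e) (lift k p) = sat e p"
  by (induction p arbitrary: k e) (auto simp: ev_lift_ins ins_ins)

lemma ev_subst: "ev e (subst_trm k s t) = ev (ins k (ev e s) e) t"
  by (induction t) (auto simp: ins_def)

lemma sat_subst: "sat e (subst k s p) = sat (ins k (ev e s) e) p"
  by (induction p arbitrary: k s e) (auto simp: ev_subst ins_ins)

lemma ev_num [simp]: "ev e (num n) = n"
  by (induction n) auto

lemma sat_connectives [simp]:
  "sat e (p \<^bold>\<and> q) \<longleftrightarrow> sat e p \<and> sat e q"
  "sat e (p \<^bold>\<or> q) \<longleftrightarrow> sat e p \<or> sat e q"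
  "sat e (p \<^bold>\<longleftrightarrow> q) \<longleftrightarrow> (sat e p \<longleftrightarrow> sat e q)"
  "sat e (Exists p) \<longleftrightarrow> (\<exists>x. sat (ins 0 x e) p)"
  by (auto simp: Conj_def Disj_def Iff_def Exists_def)

lemma sat_axiom: "axiom p \<Longrightarrow> sat e p"
proof (induction arbitrary: e rule: axiom.induct)
  case (Induction p)
  \<comment> \<open>After the exchange by \<open>ins_ins\<close>, the old \<open>x\<close> sits at
    index 1, exactly the variable that \<open>lift 1\<close> skips, and \<open>Suc x\<close> stands
    at index 0.\<close>
  have step: "sat (ins 0 x e) (subst 0 (Succ (Var 0)) (lift 1 p)) = sat (ins 0 (Suc x) e) p" for x
    by (subst sat_subst, subst ins_ins) (simp add: sat_lift flip: One_nat_def)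
  show ?case
    unfolding sat.simps step
  proof (intro impI allI)
    fix n
    assume "sat e (subst 0 Zero p)" and "\<forall>x. sat (ins 0 x e) p \<longrightarrow> sat (ins 0 (Suc x) e) p"
    then show "sat (ins 0 n e) p"
      by (induction n) (auto simp: sat_subst)
  qed
qed (auto simp: sat_subst sat_lift equality_axioms_def arithmetic_axioms_def)

lemma soundness: "\<turnstile> p \<Longrightarrow> sat e p"
  by (induction arbitrary: e rule: provable.induct) (auto simp: sat_axiom)


section \<open>Codes and sequences\<close>

text \<open>A code is at least the square of \<open>x + y\<close> and below the square of its
  successor, so it determines the sum; subtracting the square leaves \<open>x\<close>.\<close>

lemma npair_inject [simp]: "npair x y = npair x' y' \<longleftrightarrow> x = x' \<and> y = y'"
proof
  have mono: "npair x y < npair x' y'" if "x + y < x' + y'" for x y x' y'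
  proof -
    have "npair x y < Suc (x + y) * Suc (x + y)"
      by (simp add: npair_def algebra_simps)
    also have "\<dots> \<le> (x' + y') * (x' + y')"
      using that by (intro mult_le_mono) auto
    also have "\<dots> \<le> npair x' y'"
      by (simp add: npair_def)
    finally show ?thesis .
  qed
  assume eq: "npair x y = npair x' y'"
  then have "x + y = x' + y'"
    using mono[of x y x' y'] mono[of x' y' x y] by (metis less_irrefl linorder_neqE_nat)
  with eq show "x = x' \<and> y = y'"
    by (simp add: npair_def)
qed simp

text \<open>Quantifiers bounded by a code therefore reach its components; the correctness of
  \<open>Nth\<close> and \<open>Prf\<close> rests on this.\<close>

lemma le_npair: "x \<le> npair x y" "y \<le> npair x y"
proof -
  show "x \<le> npair x y"
    by (simp add: npair_def)
  have "y \<le> (x + y) * (x + y)"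
    by (cases "x + y") auto
  then show "y \<le> npair x y"
    by (simp add: npair_def)
qed

lemma ev_tpair [simp]: "ev e \<langle>s, t\<rangle> = npair (ev e s) (ev e t)"
  by (simp add: tpair_def npair_def)

lemma ev_constructors [simp]:
  "ev e (cVar t) = npair 0 (ev e t)"
  "ev e cZero = npair 1 0"
  "ev e (cSucc t) = npair 2 (ev e t)"
  "ev e (cAdd t u) = npair 3 (npair (ev e t) (ev e u))"
  "ev e (cMult t u) = npair 4 (npair (ev e t) (ev e u))"
  "ev e (cEq t u) = npair 5 (npair (ev e t) (ev e u))"
  "ev e (cNeg t) = npair 6 (ev e t)"
  "ev e (cImp t u) = npair 7 (npair (ev e t) (ev e u))"
  "ev e (cForall t) = npair 8 (ev e t)"
  by (simp_all add: cVar_def cZero_def cSucc_def cAdd_def cMult_def cEq_def cNeg_def cImp_def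
      cForall_def del: num.simps)

text \<open>As rewrite rules, these inversions let the automation read the outermost constructor off
  the tag. The tag 1 appears in its simp normal form \<open>Suc 0\<close>.\<close>

lemma npair_eq_gn_trm [simp]:
  "npair 0 x = gn_trm t \<longleftrightarrow> t = Var x"
  "npair (Suc 0) x = gn_trm t \<longleftrightarrow> x = 0 \<and> t = Zero"
  "npair 2 x = gn_trm t \<longleftrightarrow> (\<exists>u. x = gn_trm u \<and> t = Succ u)"
  "npair 3 x = gn_trm t \<longleftrightarrow> (\<exists>u v. x = npair (gn_trm u) (gn_trm v) \<and> t = Add u v)"
  "npair 4 x = gn_trm t \<longleftrightarrow> (\<exists>u v. x = npair (gn_trm u) (gn_trm v) \<and> t = Mult u v)"
  "npair 5 x \<noteq> gn_trm t" "npair 6 x \<noteq> gn_trm t" "npair 7 x \<noteq> gn_trm t"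
  "npair 8 x \<noteq> gn_trm t"
  by (cases t; auto)+

lemma npair_eq_gn [simp]:
  "npair 0 x \<noteq> gn p" "npair (Suc 0) x \<noteq> gn p" "npair 2 x \<noteq> gn p" "npair 3 x \<noteq> gn p"
  "npair 4 x \<noteq> gn p"
  "npair 5 x = gn p \<longleftrightarrow> (\<exists>t u. x = npair (gn_trm t) (gn_trm u) \<and> p = (t \<^bold>= u))"
  "npair 6 x = gn p \<longleftrightarrow> (\<exists>q. x = gn q \<and> p = Neg q)"
  "npair 7 x = gn p \<longleftrightarrow> (\<exists>q r. x = npair (gn q) (gn r) \<and> p = (q \<^bold>\<longrightarrow> r))"
  "npair 8 x = gn p \<longleftrightarrow> (\<exists>q. x = gn q \<and> p = Forall q)"
  by (cases p; auto)+

lemma gn_trm_inject [simp]: "gn_trm t = gn_trm u \<longleftrightarrow> t = u"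
  by (induction t arbitrary: u) auto

lemma gn_inject [simp]: "gn p = gn q \<longleftrightarrow> p = q"
  by (induction p arbitrary: q) auto

lemma sat_bounded [simp]:
  "sat e (Le t u) \<longleftrightarrow> ev e t \<le> ev e u"
  "sat e (Less t u) \<longleftrightarrow> ev e t < ev e u"
  "sat e (ExLe t p) \<longleftrightarrow> (\<exists>x\<le>ev e t. sat (ins 0 x e) p)"
  "sat e (ExLess t p) \<longleftrightarrow> (\<exists>x<ev e t. sat (ins 0 x e) p)"
  "sat e (AllLe t p) \<longleftrightarrow> (\<forall>x\<le>ev e t. sat (ins 0 x e) p)"
proof -
  show le: "sat e (Le t u) \<longleftrightarrow> ev e t \<le> ev e u" for e t u
    by (simp add: Le_def) (metis le_iff_add)
  show less: "sat e (Less t u) \<longleftrightarrow> ev e t < ev e u" for e t u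
    by (simp add: Less_def le Suc_le_eq)
  show "sat e (ExLe t p) \<longleftrightarrow> (\<exists>x\<le>ev e t. sat (ins 0 x e) p)"
    "sat e (ExLess t p) \<longleftrightarrow> (\<exists>x<ev e t. sat (ins 0 x e) p)"
    "sat e (AllLe t p) \<longleftrightarrow> (\<forall>x\<le>ev e t. sat (ins 0 x e) p)"
    by (auto simp: ExLe_def ExLess_def AllLe_def le less)
qed

lemma ExsLe_numeral [simp]:
  "ExsLe (numeral m) t p = ExLe t (ExsLe (pred_numeral m) (t\<up>) p)"
  by (simp add: numeral_eq_Suc)

section \<open>Coding of finite sequences by the beta function\<close>

definition entry :: "nat \<Rightarrow> nat \<Rightarrow> nat \<Rightarrow> bool" where
  "entry s i v \<longleftrightarrow> (\<exists>a b. s = npair a b \<and> v = a mod Suc (Suc i * b))"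

definition earlier :: "nat \<Rightarrow> nat \<Rightarrow> nat set" where
  "earlier s i = {v. \<exists>j<i. entry s j v}"

text \<open>The bounds in \<open>Nth\<close> lose nothing: \<open>a\<close> and \<open>b\<close> are
  components of \<open>s\<close>, and the quotient is at most \<open>a\<close>. The last conjunct of
  \<open>Nth\<close> keeps the remainder below the modulus.\<close>

lemma sat_Nth [simp]: "sat e (Nth s i v) \<longleftrightarrow> entry (ev e s) (ev e i) (ev e v)"
proof -
  have "(\<exists>a\<le>s. \<exists>b\<le>s. \<exists>q\<le>s. s = npair a b \<and> a = q * Suc (Suc i * b) + v \<and> v \<le> Suc i * b)
    \<longleftrightarrow> entry s i v" (is "?L \<longleftrightarrow> _") for s i v :: nat
  proof
    assume ?L
    then obtain a b q where s: "s = npair a b"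
      and a: "a = q * Suc (Suc i * b) + v" and "v \<le> Suc i * b"
      by blast
    then have "v < Suc (Suc i * b)"
      by simp
    then have "a mod Suc (Suc i * b) = v"
      unfolding a by (metis mod_less mod_mult_self3)
    with s show "entry s i v"
      unfolding entry_def by blast
  next
    assume "entry s i v"
    then obtain a b where s: "s = npair a b" and v: "v = a mod Suc (Suc i * b)"
      unfolding entry_def by blast
    let ?q = "a div Suc (Suc i * b)"
    have "a \<le> s" "b \<le> s"
      unfolding s by (rule le_npair)+
    moreover have "?q \<le> s"
      using div_le_dividend \<open>a \<le> s\<close> by (rule order_trans)
    moreover have "a = ?q * Suc (Suc i * b) + v"
      unfolding v by (rule div_mult_mod_eq[symmetric])
    moreover have "v \<le> Suc i * b"
      unfolding v by (rule less_Suc_eq_le[THEN iffD1, OF mod_less_divisor]) (rule zero_less_Suc)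
    ultimately show ?L
      using s by blast
  qed
  from this[of "ev e s" "ev e i" "ev e v"] show ?thesis
    by (simp add: Nth_def)
qed

lemma sat_Earlier [simp]: "sat e (Earlier s i v) \<longleftrightarrow> ev e v \<in> earlier (ev e s) (ev e i)"
  by (simp add: Earlier_def earlier_def)

text \<open>A common divisor of both moduli is coprime to \<open>b\<close>, since each modulus is a
  multiple of \<open>b\<close> plus 1. It divides the difference \<open>(j - i) * b\<close>, hence
  \<open>j - i\<close>, hence \<open>fact n\<close> and thus \<open>b\<close>; so it is a
  unit.\<close>

lemma coprime_beta_moduli:
  fixes b :: nat
  assumes b: "fact n dvd b" and "i < j" "j \<le> n"
  shows "coprime (Suc (Suc i * b)) (Suc (Suc j * b))"
proof (rule coprimeI)
  fix c
  assume i: "c dvd Suc (Suc i * b)" and j: "c dvd Suc (Suc j * b)"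
  have "coprime c b"
    using i
    by (metis coprime_Suc_right_nat coprime_commute coprime_divisors coprime_mult_left_iff dvd_refl)
  have "Suc (Suc j * b) = Suc (Suc i * b) + (j - i) * b"
    using \<open>i < j\<close> by (simp add: algebra_simps flip: distrib_right)
  then have "c dvd (j - i) * b"
    using i j by (metis dvd_add_right_iff)
  then have "c dvd j - i"
    using \<open>coprime c b\<close> by (simp add: coprime_dvd_mult_left_iff)
  also have "j - i dvd fact n"
    using assms by (intro dvd_fact) auto
  finally have "c dvd b"
    using b by (rule dvd_trans)
  then show "is_unit c"
    using \<open>coprime c b\<close> by (auto simp: coprime_absorb_left)
qed

lemma sequence_code_exists:
  obtains s where "\<And>i v. i < length vs \<Longrightarrow> entry s i v \<longleftrightarrow> v = vs ! i"
proof -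
  define n where "n = length vs"
  \<comment> \<open>The factorial makes the moduli pairwise coprime; the other factor makes each of
    them exceed every entry, so that remainders are the entries themselves.\<close>
  define b where "b = fact n * Suc (sum_list vs)"
  have "fact n dvd b"
    by (simp add: b_def)
  then have "coprime (Suc (Suc i * b)) (Suc (Suc j * b))" if "i < n" "j < n" "i \<noteq> j" for i j
    using that coprime_beta_moduli[of n b i j] coprime_beta_moduli[of n b j i]
    by (metis coprime_commute less_imp_le linorder_neqE_nat)
  then obtain a where a: "\<forall>i\<in>{..<n}. [a = vs ! i] (mod Suc (Suc i * b))"
    using chinese_remainder_nat[of "{..<n}" "\<lambda>i. Suc (Suc i * b)" "(!) vs"] by auto
  have "a mod Suc (Suc i * b) = vs ! i" if "i < n" for i
  proof -
    have "vs ! i \<le> sum_list vs"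
      using that by (simp add: n_def elem_le_sum_list)
    also have "\<dots> < 1 * Suc (sum_list vs)"
      by simp
    also have "\<dots> \<le> b"
      unfolding b_def by (intro mult_le_mono1) (simp add: Suc_le_eq)
    finally have "vs ! i < Suc (Suc i * b)"
      by simp
    then show ?thesis
      using a that by (auto simp: cong_def)
  qed
  then have "entry (npair a b) i v \<longleftrightarrow> v = vs ! i" if "i < length vs" for i v
    using that unfolding entry_def n_def by auto
  then show thesis
    by (rule that)
qed


section \<open>Derivations in the standard model\<close>

definition sem :: "rules \<Rightarrow> nat \<Rightarrow> nat \<Rightarrow> nat \<Rightarrow> nat \<Rightarrow> bool" where
  "sem step w s i v \<longleftrightarrow> sat (\<lambda>_. 0) (step (num w) (num s) (num i) (num v))"

text \<open>A function of type \<open>rules\<close> could inspect the syntax of its arguments or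
  mention variables of its own. If only the values of the arguments matter, evaluation at numerals
  in the zero environment, as in \<open>sem\<close>, is representative.\<close>

definition extensional :: "rules \<Rightarrow> bool" where
  "extensional step \<longleftrightarrow>
    (\<forall>e w s i v. sat e (step w s i v) \<longleftrightarrow> sem step (ev e w) (ev e s) (ev e i) (ev e v))"

definition derivation :: "rules \<Rightarrow> nat \<Rightarrow> nat \<Rightarrow> nat \<Rightarrow> nat \<Rightarrow> bool" where
  "derivation step w s n x \<longleftrightarrow>
    entry s n x \<and> (\<forall>i\<le>n. \<exists>v\<le>w. entry s i v \<and> sem step w s i v)"

definition derivable :: "rules \<Rightarrow> nat \<Rightarrow> nat \<Rightarrow> bool" where
  "derivable step w x \<longleftrightarrow> (\<exists>s\<le>w. \<exists>n\<le>w. derivation step w s n x)"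

lemma sat_Derivation:
  assumes "extensional step"
  shows "sat e (Derivation step w s n x) \<longleftrightarrow> derivation step (ev e w) (ev e s) (ev e n) (ev e x)"
  using assms by (simp add: Derivation_def derivation_def extensional_def)

lemma sat_Derivable:
  assumes "extensional step"
  shows "sat e (Derivable step w x) \<longleftrightarrow> derivable step (ev e w) (ev e x)"
  by (simp add: Derivable_def derivable_def sat_Derivation[OF assms])

lemma entry_unique: "entry s i v \<Longrightarrow> entry s i v' \<Longrightarrow> v = v'"
  by (auto simp: entry_def)

text \<open>Strong induction on the line number. By uniqueness of entries, the line that the bounded
  quantifier provides is the entry under consideration.\<close>

lemma derivation_sound:
  assumes deriv: "derivation step w s n x"
    and closed: "\<And>i v. sem step w s i v \<Longrightarrow> (\<And>u. u \<in> earlier s i \<Longrightarrow> R u) \<Longrightarrow> R v"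
  shows "R x"
proof -
  have "R v" if "i \<le> n" "entry s i v" for i v
    using that
  proof (induction i arbitrary: v rule: less_induct)
    case (less i)
    then have "sem step w s i v"
      using deriv entry_unique by (metis derivation_def)
    then show ?case
      by (rule closed) (use less in \<open>auto simp: earlier_def\<close>)
  qed
  then show ?thesis
    using deriv by (auto simp: derivation_def)
qed

lemma derivable_sound:
  assumes "derivable step w x"
    and "\<And>s i v. sem step w s i v \<Longrightarrow> (\<And>u. u \<in> earlier s i \<Longrightarrow> R u) \<Longrightarrow> R v"
  shows "R x"
  using assms derivation_sound[where R = R] unfolding derivable_def by metis

text \<open>
  Different steps need different bounds \<open>w\<close>, so a step is required to hold for all sufficiently
  large \<open>w\<close>; finitely many such requirements can be met simultaneously. Quantifying over all
  \<open>s\<close> and \<open>i\<close> with enough earlier entries makes derivations closed under concatenation.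
\<close>

definition lines :: "rules \<Rightarrow> nat list \<Rightarrow> bool" where
  "lines step vs \<longleftrightarrow> (\<forall>k<length vs. \<forall>s i. set (take k vs) \<subseteq> earlier s i \<longrightarrow>
    (\<forall>\<^sub>F w in sequentially. sem step w s i (vs ! k)))"

definition generated :: "rules \<Rightarrow> nat \<Rightarrow> bool" where
  "generated step x \<longleftrightarrow> (\<exists>vs. lines step vs \<and> x \<in> set vs)"

lemma lines_append:
  assumes "lines step us" "lines step vs"
  shows "lines step (us @ vs)"
  using assms by (auto simp: lines_def nth_append)

text \<open>The tool for all completeness proofs: \<open>us\<close> lists the premises of one rule
  application. The line lists that generate them are concatenated, and \<open>v\<close> is appended
  as last line.\<close>

lemma generatedI:
  assumes "\<forall>u\<in>set us. generated step u"
    and step: "\<And>s i. set us \<subseteq> earlier s i \<Longrightarrow> \<forall>\<^sub>F w in sequentially. sem step w s i v"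
  shows "generated step v"
proof -
  have "\<exists>vs. lines step vs \<and> set us \<subseteq> set vs"
    using assms(1)
  proof (induction us)
    case Nil
    show ?case
      by (auto simp: lines_def intro: exI[of _ "[]"])
  next
    case (Cons u us)
    then obtain vs vs' where "lines step vs" "set us \<subseteq> set vs" "lines step vs'" "u \<in> set vs'"
      by (auto simp: generated_def)
    then show ?case
      using lines_append by (intro exI[of _ "vs @ vs'"]) auto
  qed
  then obtain vs where "lines step vs" "set us \<subseteq> set vs"
    by blast
  then have "lines step (vs @ [v])"
    using step by (auto simp: lines_def nth_append less_Suc_eq)
  then show ?thesis
    by (auto simp: generated_def)
qed

text \<open>The code \<open>s\<close> of the lines is chosen first and \<open>w\<close> only
  afterwards. Each of the finitely many lines is correct for all large \<open>w\<close>, so one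
  bound serves them all.\<close>

lemma generated_derivable:
  assumes "generated step x"
  shows "\<forall>\<^sub>F w in sequentially. derivable step w x"
proof -
  obtain vs n where lines: "lines step vs" and n: "n < length vs" "x = vs ! n"
    using assms by (auto simp: generated_def in_set_conv_nth)
  obtain s where s: "\<And>i v. i < length vs \<Longrightarrow> entry s i v \<longleftrightarrow> v = vs ! i"
    using sequence_code_exists by blast
  have "\<forall>\<^sub>F w in sequentially. sem step w s i (vs ! i) \<and> vs ! i \<le> w" if "i \<le> n" for i
  proof -
    have "entry s j (vs ! j)" if "j < i" for j
      using that \<open>i \<le> n\<close> n s by simp
    then have "set (take i vs) \<subseteq> earlier s i"
      by (auto simp: earlier_def in_set_conv_nth) blast
    then have "\<forall>\<^sub>F w in sequentially. sem step w s i (vs ! i)"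
      using lines that n by (auto simp: lines_def)
    then show ?thesis
      using eventually_ge_at_top by (rule eventually_conj)
  qed
  then have "\<forall>\<^sub>F w in sequentially. \<forall>i\<in>{..n}. sem step w s i (vs ! i) \<and> vs ! i \<le> w"
    by (intro eventually_ball_finite) auto
  \<comment> \<open>\<open>derivable\<close> bounds the code of the sequence and the number of its
    last line by \<open>w\<close> too.\<close>
  moreover have "\<forall>\<^sub>F w in sequentially. s + n \<le> w"
    by (rule eventually_ge_at_top)
  ultimately show ?thesis
  proof eventually_elim
    case (elim w)
    then have "derivation step w s n x"
      using n s by (auto simp: derivation_def)
    then show ?case
      using elim unfolding derivable_def by (meson add_leE)
  qed
qed


section \<open>Correctness of the arithmetized syntax\<close>

lemma extensional_term_step: "extensional term_step"
  by (simp add: extensional_def sem_def term_step_def)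

lemma sat_IsTerm [simp]: "sat e (IsTerm w x) \<longleftrightarrow> derivable term_step (ev e w) (ev e x)"
  by (simp add: IsTerm_def sat_Derivable extensional_term_step)

lemma term_sound:
  assumes "derivable term_step w x"
  shows "\<exists>t. x = gn_trm t"
  using assms
proof (rule derivable_sound[where R = "\<lambda>v. \<exists>t. v = gn_trm t"])
  fix s i v
  assume "sem term_step w s i v" and IH: "\<And>u. u \<in> earlier s i \<Longrightarrow> \<exists>t. u = gn_trm t"
  then show "\<exists>t. v = gn_trm t"
    by (auto simp: sem_def term_step_def dest!: IH)
qed

text \<open>In each case the list given to \<open>generatedI\<close> contains the codes of the
  immediate subterms, and the threshold for \<open>w\<close>, where there is one, dominates the
  witnesses of the rule.\<close>

lemma term_complete: "\<forall>\<^sub>F w in sequentially. derivable term_step w (gn_trm t)"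
proof (rule generated_derivable, induction t)
  case (Var n)
  show ?case
    by (rule generatedI[of "[]"], simp, rule eventually_sequentiallyI[of n])
      (simp add: sem_def term_step_def)
next
  case Zero
  show ?case
    by (rule generatedI[of "[]"]) (simp_all add: sem_def term_step_def)
next
  case (Succ t)
  then show ?case
    by (intro generatedI[of "[gn_trm t]"], simp, intro eventually_sequentiallyI[of "gn_trm t"])
      (simp add: sem_def term_step_def)
next
  case (Add t u)
  then show ?case
    by (intro generatedI[of "[gn_trm t, gn_trm u]"], simp,
        intro eventually_sequentiallyI[of "gn_trm t + gn_trm u"])
      (simp add: sem_def term_step_def)
next
  case (Mult t u)
  then show ?case
    by (intro generatedI[of "[gn_trm t, gn_trm u]"], simp,
        intro eventually_sequentiallyI[of "gn_trm t + gn_trm u"])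
      (simp add: sem_def term_step_def)
qed

section \<open>Codes of formulas\<close>

lemma extensional_form_step: "extensional form_step"
  by (simp add: extensional_def sem_def form_step_def)

lemma sat_IsForm [simp]: "sat e (IsForm w x) \<longleftrightarrow> derivable form_step (ev e w) (ev e x)"
  by (simp add: IsForm_def sat_Derivable extensional_form_step)

lemma form_sound:
  assumes "derivable form_step w x"
  shows "\<exists>p. x = gn p"
  using assms
proof (rule derivable_sound[where R = "\<lambda>v. \<exists>p. v = gn p"])
  fix s i v
  assume "sem form_step w s i v" and IH: "\<And>u. u \<in> earlier s i \<Longrightarrow> \<exists>p. u = gn p"
  then show "\<exists>p. v = gn p"
    by (auto simp: sem_def form_step_def dest!: IH term_sound)
qed

lemma form_complete: "\<forall>\<^sub>F w in sequentially. derivable form_step w (gn p)"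
proof (rule generated_derivable, induction p)
  case (Eq t u)
  show ?case
  proof (rule generatedI[of "[]"])
    fix s i
    show "\<forall>\<^sub>F w in sequentially. sem form_step w s i (gn (t \<^bold>= u))"
      \<comment> \<open>The same \<open>w\<close> must also bound the nested derivations for the two
        terms.\<close>
      using term_complete[of t] term_complete[of u] eventually_ge_at_top[of "gn_trm t + gn_trm u"]
      by eventually_elim (simp add: sem_def form_step_def)
  qed simp
next
  case (Neg p)
  then show ?case
    by (intro generatedI[of "[gn p]"], simp, intro eventually_sequentiallyI[of "gn p"])
      (simp add: sem_def form_step_def)
next
  case (Imp p q)
  then show ?case
    by (intro generatedI[of "[gn p, gn q]"], simp, intro eventually_sequentiallyI[of "gn p + gn q"])
      (simp add: sem_def form_step_def)
next
  case (Forall p)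
  then show ?case
    by (intro generatedI[of "[gn p]"], simp, intro eventually_sequentiallyI[of "gn p"])
      (simp add: sem_def form_step_def)
qed

section \<open>Lifting\<close>

lemma extensional_lift_step: "extensional lift_step"
  by (simp add: extensional_def sem_def lift_step_def Let_def)

lemma sat_IsLift [simp]:
  "sat e (IsLift w k x y) \<longleftrightarrow>
    derivable lift_step (ev e w) (npair (ev e k) (npair (ev e x) (ev e y)))"
  by (simp add: IsLift_def sat_Derivable extensional_lift_step)

text \<open>The rules do not separate terms from formulas, so they also derive junk such as the
  successor of an equation. Conditioning on \<open>x\<close> being a genuine code makes such entries
  harmless and keeps the invariant closed under the rules.\<close>

definition lift_rel :: "nat \<Rightarrow> bool" where
  "lift_rel v \<longleftrightarrow> (\<forall>k x y. v = npair k (npair x y) \<longrightarrow>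
    (\<forall>t. x = gn_trm t \<longrightarrow> y = gn_trm (lift_trm k t)) \<and>
    (\<forall>p. x = gn p \<longrightarrow> y = gn (lift k p)))"

lemma lift_rel_npair:
  "lift_rel (npair k (npair x y)) \<longleftrightarrow>
    (\<forall>t. x = gn_trm t \<longrightarrow> y = gn_trm (lift_trm k t)) \<and>
    (\<forall>p. x = gn p \<longrightarrow> y = gn (lift k p))"
  by (auto simp: lift_rel_def)

lemma lift_sound:
  assumes "derivable lift_step w v"
  shows "lift_rel v"
  using assms
proof (rule derivable_sound)
  fix s i v
  assume "sem lift_step w s i v" and IH: "\<And>u. u \<in> earlier s i \<Longrightarrow> lift_rel u"
  then show "lift_rel v"
    by (auto simp: sem_def lift_step_def Let_def lift_rel_npair dest!: IH)
qed

lemma generated_lift_trm: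
  "generated lift_step (npair k (npair (gn_trm t) (gn_trm (lift_trm k t))))"
proof (induction t)
  case (Var n)
  show ?case
    \<comment> \<open>The rule is a disjunction under quantifiers; once these are distributed over
      it, the equation in each disjunct determines the witnesses.\<close>
    by (rule generatedI[of "[]"], simp, rule eventually_sequentiallyI[of "k + n"])
      (auto simp: sem_def lift_step_def Let_def conj_disj_distribL ex_disj_distrib)
next
  case Zero
  show ?case
    by (rule generatedI[of "[]"], simp, rule eventually_sequentiallyI[of "k"])
      (simp add: sem_def lift_step_def Let_def)
next
  case (Succ t)
  then show ?case
    by (intro generatedI[of "[npair k (npair (gn_trm t) (gn_trm (lift_trm k t)))]"], simp,
        intro eventually_sequentiallyI[of "k + gn_trm t + gn_trm (lift_trm k t)"])
      (simp add: sem_def lift_step_def Let_def)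
next
  case (Add t u)
  then show ?case
    by (intro generatedI[of "[npair k (npair (gn_trm t) (gn_trm (lift_trm k t))),
          npair k (npair (gn_trm u) (gn_trm (lift_trm k u)))]"], simp,
        intro eventually_sequentiallyI[of "k + gn_trm t + gn_trm (lift_trm k t)
          + gn_trm u + gn_trm (lift_trm k u)"])
      (simp add: sem_def lift_step_def Let_def)
next
  case (Mult t u)
  then show ?case
    by (intro generatedI[of "[npair k (npair (gn_trm t) (gn_trm (lift_trm k t))),
          npair k (npair (gn_trm u) (gn_trm (lift_trm k u)))]"], simp,
        intro eventually_sequentiallyI[of "k + gn_trm t + gn_trm (lift_trm k t)
          + gn_trm u + gn_trm (lift_trm k u)"])
      (simp add: sem_def lift_step_def Let_def)
qed

text \<open>The index \<open>k\<close> varies in the induction because a quantifier raises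
  it.\<close>

lemma generated_lift: "generated lift_step (npair k (npair (gn p) (gn (lift k p))))"
proof (induction p arbitrary: k)
  case (Eq t u)
  show ?case
    using generated_lift_trm[of k t] generated_lift_trm[of k u]
    by (intro generatedI[of "[npair k (npair (gn_trm t) (gn_trm (lift_trm k t))),
          npair k (npair (gn_trm u) (gn_trm (lift_trm k u)))]"], simp,
        intro eventually_sequentiallyI[of "k + gn_trm t + gn_trm (lift_trm k t)
          + gn_trm u + gn_trm (lift_trm k u)"])
      (simp add: sem_def lift_step_def Let_def)
next
  case (Neg p)
  then show ?case
    by (intro generatedI[of "[npair k (npair (gn p) (gn (lift k p)))]"], simp,
        intro eventually_sequentiallyI[of "k + gn p + gn (lift k p)"])
      (simp add: sem_def lift_step_def Let_def)
next
  case (Imp p q)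
  then show ?case
    by (intro generatedI[of "[npair k (npair (gn p) (gn (lift k p))),
          npair k (npair (gn q) (gn (lift k q)))]"], simp,
        intro eventually_sequentiallyI[of "k + gn p + gn (lift k p) + gn q + gn (lift k q)"])
      (simp add: sem_def lift_step_def Let_def)
next
  case (Forall p)
  then show ?case
    by (intro generatedI[of "[npair (Suc k) (npair (gn p) (gn (lift (Suc k) p)))]"], simp,
        intro eventually_sequentiallyI[of "k + gn p + gn (lift (Suc k) p)"])
      (simp add: sem_def lift_step_def Let_def)
qed

lemmas lift_trm_complete = generated_derivable[OF generated_lift_trm]
lemmas lift_complete = generated_derivable[OF generated_lift]

section \<open>Substitution\<close>

lemma extensional_subst_step: "extensional subst_step"
  by (simp add: extensional_def sem_def subst_step_def Let_def)

lemma sat_IsSubst [simp]: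
  "sat e (IsSubst w k t x y) \<longleftrightarrow>
    derivable subst_step (ev e w) (npair (ev e k) (npair (ev e t) (npair (ev e x) (ev e y))))"
  by (simp add: IsSubst_def sat_Derivable extensional_subst_step)

text \<open>Conditional for the same reason as \<open>lift_rel\<close>, and also in the substituted
  term: the rules for variables and zero accept any number in its place.\<close>

definition subst_rel :: "nat \<Rightarrow> bool" where
  "subst_rel v \<longleftrightarrow> (\<forall>k s x y. v = npair k (npair (gn_trm s) (npair x y)) \<longrightarrow>
    (\<forall>t. x = gn_trm t \<longrightarrow> y = gn_trm (subst_trm k s t)) \<and>
    (\<forall>p. x = gn p \<longrightarrow> y = gn (subst k s p)))"

lemma subst_rel_npair:
  "subst_rel (npair k (npair z (npair x y))) \<longleftrightarrow> (\<forall>s. z = gn_trm s \<longrightarrow>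
    (\<forall>t. x = gn_trm t \<longrightarrow> y = gn_trm (subst_trm k s t)) \<and>
    (\<forall>p. x = gn p \<longrightarrow> y = gn (subst k s p)))"
  by (auto simp: subst_rel_def)

lemma subst_sound:
  assumes "derivable subst_step w v"
  shows "subst_rel v"
  using assms
proof (rule derivable_sound)
  fix s i v
  assume "sem subst_step w s i v" and IH: "\<And>u. u \<in> earlier s i \<Longrightarrow> subst_rel u"
  then show "subst_rel v"
    by (auto simp: sem_def subst_step_def Let_def subst_rel_npair lift_rel_npair
        dest!: IH lift_sound)
qed

lemma generated_subst_trm:
  "generated subst_step
    (npair k (npair (gn_trm s) (npair (gn_trm t) (gn_trm (subst_trm k s t)))))"
proof (induction t)
  case (Var n)
  show ?case
  proof (rule generatedI[of "[]"], simp, rule eventually_sequentiallyI[of "k + gn_trm s + n"])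
    fix j i w
    assume "k + gn_trm s + n \<le> w"
    then show "sem subst_step w j i
        (npair k (npair (gn_trm s) (npair (gn_trm (Var n)) (gn_trm (subst_trm k s (Var n))))))"
      \<comment> \<open>Above \<open>k\<close>, the rule writes the variable as a successor and
        returns its predecessor, so \<open>n\<close> itself has to be split as well.\<close>
      by (cases n k rule: linorder_cases; cases n)
        (auto simp: sem_def subst_step_def Let_def conj_disj_distribL ex_disj_distrib)
  qed
next
  case Zero
  show ?case
    by (rule generatedI[of "[]"], simp, rule eventually_sequentiallyI[of "k + gn_trm s"])
      (simp add: sem_def subst_step_def Let_def)
next
  case (Succ t)
  then show ?case
    by (intro generatedI[of "[
          npair k (npair (gn_trm s) (npair (gn_trm t) (gn_trm (subst_trm k s t))))]"], simp,
        intro eventually_sequentiallyI[of "k + gn_trm s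
          + gn_trm t + gn_trm (subst_trm k s t)"])
      (simp add: sem_def subst_step_def Let_def)
next
  case (Add t u)
  then show ?case
    by (intro generatedI[of "[
          npair k (npair (gn_trm s) (npair (gn_trm t) (gn_trm (subst_trm k s t)))),
          npair k (npair (gn_trm s) (npair (gn_trm u) (gn_trm (subst_trm k s u))))]"], simp,
        intro eventually_sequentiallyI[of "k + gn_trm s
          + gn_trm t + gn_trm (subst_trm k s t)
          + gn_trm u + gn_trm (subst_trm k s u)"])
      (simp add: sem_def subst_step_def Let_def)
next
  case (Mult t u)
  then show ?case
    by (intro generatedI[of "[
          npair k (npair (gn_trm s) (npair (gn_trm t) (gn_trm (subst_trm k s t)))),
          npair k (npair (gn_trm s) (npair (gn_trm u) (gn_trm (subst_trm k s u))))]"], simp,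
        intro eventually_sequentiallyI[of "k + gn_trm s
          + gn_trm t + gn_trm (subst_trm k s t)
          + gn_trm u + gn_trm (subst_trm k s u)"])
      (simp add: sem_def subst_step_def Let_def)
qed

text \<open>Below a quantifier the index is raised and the substituted term is lifted, so both
  \<open>k\<close> and \<open>s\<close> vary in the induction.\<close>

lemma generated_subst:
  "generated subst_step (npair k (npair (gn_trm s) (npair (gn p) (gn (subst k s p)))))"
proof (induction p arbitrary: k s)
  case (Eq t u)
  show ?case
    using generated_subst_trm[of k s t] generated_subst_trm[of k s u]
    by (intro generatedI[of "[
          npair k (npair (gn_trm s) (npair (gn_trm t) (gn_trm (subst_trm k s t)))),
          npair k (npair (gn_trm s) (npair (gn_trm u) (gn_trm (subst_trm k s u))))]"], simp,
        intro eventually_sequentiallyI[of "k + gn_trm s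
          + gn_trm t + gn_trm (subst_trm k s t)
          + gn_trm u + gn_trm (subst_trm k s u)"])
      (simp add: sem_def subst_step_def Let_def)
next
  case (Neg p)
  then show ?case
    by (intro generatedI[of "[
          npair k (npair (gn_trm s) (npair (gn p) (gn (subst k s p))))]"], simp,
        intro eventually_sequentiallyI[of "k + gn_trm s
          + gn p + gn (subst k s p)"])
      (simp add: sem_def subst_step_def Let_def)
next
  case (Imp p q)
  then show ?case
    by (intro generatedI[of "[
          npair k (npair (gn_trm s) (npair (gn p) (gn (subst k s p)))),
          npair k (npair (gn_trm s) (npair (gn q) (gn (subst k s q))))]"], simp,
        intro eventually_sequentiallyI[of "k + gn_trm s
          + gn p + gn (subst k s p)
          + gn q + gn (subst k s q)"])
      (simp add: sem_def subst_step_def Let_def)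
next
  case (Forall p)
  let ?u = "npair (Suc k) (npair (gn_trm (s\<up>)) (npair (gn p) (gn (subst (Suc k) (s\<up>) p))))"
  show ?case
  proof (rule generatedI[of "[?u]"])
    show "\<forall>u\<in>set [?u]. generated subst_step u"
      using Forall by simp
  next
    fix j i
    assume "set [?u] \<subseteq> earlier j i"
    then have u: "?u \<in> earlier j i"
      by simp
    show "\<forall>\<^sub>F w in sequentially. sem subst_step w j i
        (npair k (npair (gn_trm s) (npair (gn (Forall p)) (gn (subst k s (Forall p))))))"
      \<comment> \<open>The quantifier rule contains \<open>IsLift\<close>, so \<open>w\<close> must
        also bound a derivation of the lifted \<open>s\<close>.\<close>
      using lift_trm_complete[of 0 s]
        eventually_ge_at_top[of k] eventually_ge_at_top[of "gn_trm s"]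
        eventually_ge_at_top[of "gn_trm (s\<up>)"]
        eventually_ge_at_top[of "gn p + gn (subst (Suc k) (s\<up>) p)"]
      by eventually_elim (use u in \<open>simp add: sem_def subst_step_def Let_def, blast\<close>)
  qed
qed

lemmas subst_complete = generated_derivable[OF generated_subst]

section \<open>Numerals\<close>

lemma extensional_num_step: "extensional num_step"
  by (simp add: extensional_def sem_def num_step_def)

lemma sat_IsNum [simp]:
  "sat e (IsNum w n y) \<longleftrightarrow> derivable num_step (ev e w) (npair (ev e n) (ev e y))"
  by (simp add: IsNum_def sat_Derivable extensional_num_step)

lemma num_sound:
  assumes "derivable num_step w (npair n y)"
  shows "y = gn_trm (num n)"
proof -
  \<comment> \<open>The invariant speaks of arbitrary entries, so it quantifies over the number
    coded; injectivity of pairing afterwards identifies that number with \<open>n\<close>.\<close>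
  have "\<exists>m. npair n y = npair m (gn_trm (num m))"
    using assms
  proof (rule derivable_sound[where R = "\<lambda>v. \<exists>m. v = npair m (gn_trm (num m))"])
    fix s i v
    assume "sem num_step w s i v"
      and IH: "\<And>u. u \<in> earlier s i \<Longrightarrow> \<exists>m. u = npair m (gn_trm (num m))"
    then show "\<exists>m. v = npair m (gn_trm (num m))"
      by (auto simp: sem_def num_step_def dest!: IH intro: exI[of _ 0] exI[of _ "Suc _"])
  qed
  then show ?thesis
    by auto
qed

lemma num_complete: "\<forall>\<^sub>F w in sequentially. derivable num_step w (npair n (gn_trm (num n)))"
proof (rule generated_derivable, induction n)
  case 0
  show ?case
    by (rule generatedI[of "[]"]) (simp_all add: sem_def num_step_def)
next
  case (Suc n)
  then show ?case
    by (intro generatedI[of "[npair n (gn_trm (num n))]"], simp,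
        intro eventually_sequentiallyI[of "n + gn_trm (num n)"])
      (simp add: sem_def num_step_def)
qed


section \<open>Correctness of the provability predicate\<close>

lemma sat_IsOneOf [simp]: "sat e (IsOneOf ps v) \<longleftrightarrow> ev e v \<in> gn ` set ps"
  by (induction ps) auto

text \<open>The conjuncts \<open>IsForm\<close> and \<open>IsTerm\<close> supply genuine codes,
  which is what makes the conditional relations for lifting and substitution determine their
  results.\<close>

lemma axiom_sound:
  assumes "sat e (IsAxiom w v)"
  shows "\<exists>p. ev e v = gn p \<and> axiom p"
  using assms
  by (auto simp: IsAxiom_def Let_def subst_rel_npair lift_rel_npair
      dest!: form_sound term_sound lift_sound subst_sound
      intro: axiom.intros axiom.Induction[unfolded One_nat_def])

text \<open>For each schema, \<open>w\<close> has to exceed the codes of its components and to bound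
  all side computations. The chain of \<open>disjI\<close> rules picks the disjunct of the schema;
  \<open>K\<close> and \<open>Contrapos\<close> share the first one.\<close>

lemma axiom_complete:
  assumes "axiom p"
  shows "\<forall>\<^sub>F w in sequentially. sat e (IsAxiom (num w) (num (gn p)))"
  using assms
proof cases
  case (K q r)
  show ?thesis
    unfolding K IsAxiom_def Let_def sat_connectives
    using form_complete[of q] form_complete[of r]
      eventually_ge_at_top[of "gn q + gn r"]
    by eventually_elim (rule disjI1, simp add: conj_disj_distribL ex_disj_distrib)
next
  case (S q r t)
  show ?thesis
    unfolding S IsAxiom_def Let_def sat_connectives
    using form_complete[of q] form_complete[of r] form_complete[of t]
      eventually_ge_at_top[of "gn q + gn r + gn t"]
    by eventually_elim (rule disjI2, rule disjI1, simp)
next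
  case (Contrapos q r)
  show ?thesis
    unfolding Contrapos IsAxiom_def Let_def sat_connectives
    using form_complete[of q] form_complete[of r]
      eventually_ge_at_top[of "gn q + gn r"]
    by eventually_elim (rule disjI1, simp add: conj_disj_distribL ex_disj_distrib)
next
  case (Instance q t)
  show ?thesis
    unfolding Instance IsAxiom_def Let_def sat_connectives
    using form_complete[of q] term_complete[of t] subst_complete[of 0 t q]
      eventually_ge_at_top[of "gn_trm t"]
      eventually_ge_at_top[of "gn q"]
      eventually_ge_at_top[of "gn (subst 0 t q)"]
    by eventually_elim (rule disjI2, rule disjI2, rule disjI1, simp, blast)
next
  case (Distrib q r)
  show ?thesis
    unfolding Distrib IsAxiom_def Let_def sat_connectives
    using form_complete[of q] form_complete[of r] lift_complete[of 0 q]
      eventually_ge_at_top[of "gn q + gn r + gn (lift 0 q)"]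
    by eventually_elim (rule disjI2, rule disjI2, rule disjI2, rule disjI1, simp)
next
  case Equality
  then show ?thesis
    by (simp add: IsAxiom_def)
next
  case Arithmetic
  then show ?thesis
    by (simp add: IsAxiom_def)
next
  case (Induction q)
  show ?thesis
    unfolding Induction IsAxiom_def Let_def sat_connectives
    using form_complete[of q] subst_complete[of 0 Zero q] lift_complete[of 1 q]
      subst_complete[of 0 "Succ (Var 0)" "lift 1 q"]
      eventually_ge_at_top[of "gn q"] eventually_ge_at_top[of "gn (subst 0 Zero q)"]
      eventually_ge_at_top[of "gn (lift 1 q)"]
      eventually_ge_at_top[of "gn (subst 0 (Succ (Var 0)) (lift 1 q))"]
    by eventually_elim
      (rule disjI2, rule disjI2, rule disjI2, rule disjI2, rule disjI2, rule disjI2, simp, blast)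
qed

lemma extensional_proof_step: "extensional proof_step"
  by (simp add: extensional_def sem_def proof_step_def IsAxiom_def Let_def)

lemma proof_sound:
  assumes "derivation proof_step w s n x"
  shows "\<exists>p. x = gn p \<and> \<turnstile> p"
  using assms
proof (rule derivation_sound[where R = "\<lambda>v. \<exists>p. v = gn p \<and> \<turnstile> p"])
  fix i v
  assume "sem proof_step w s i v" and IH: "\<And>u. u \<in> earlier s i \<Longrightarrow> \<exists>p. u = gn p \<and> \<turnstile> p"
  then show "\<exists>p. v = gn p \<and> \<turnstile> p"
    by (auto simp: sem_def proof_step_def dest!: IH axiom_sound
        intro: provable.Axiom Generalization) (metis ModusPonens)
qed

lemma generated_proof:
  assumes "\<turnstile> p"
  shows "generated proof_step (gn p)"
  using assms
proof induction
  case (Axiom p)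
  show ?case
  proof (rule generatedI[of "[]"])
    fix s i
    show "\<forall>\<^sub>F w in sequentially. sem proof_step w s i (gn p)"
      using axiom_complete[OF Axiom, of "\<lambda>_. 0"]
      by eventually_elim (simp add: sem_def proof_step_def)
  qed simp
next
  case (ModusPonens p q)
  then show ?case
    by (intro generatedI[of "[gn (p \<^bold>\<longrightarrow> q), gn p]"], simp, intro eventually_sequentiallyI[of "gn p"])
      (auto simp: sem_def proof_step_def)
next
  case (Generalization p)
  then show ?case
    by (intro generatedI[of "[gn p]"], simp, intro eventually_sequentiallyI[of "gn p"])
      (auto simp: sem_def proof_step_def)
qed

text \<open>The bounded quantifiers of \<open>Prf\<close> may be replaced by unbounded ones, as the
  components of a proof code never exceed it.\<close>

lemma sat_Prf:
  "sat e (Prf y x) \<longleftrightarrow>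
    (\<exists>w s n. ev e y = npair w (npair s n) \<and> derivation proof_step w s n (ev e x))"
proof -
  have "w \<le> npair w (npair s n)" "s \<le> npair w (npair s n)" "n \<le> npair w (npair s n)" for w s n
    by (rule le_npair order_trans[OF le_npair(1) le_npair(2)]
        order_trans[OF le_npair(2) le_npair(2)])+
  then show ?thesis
    by (auto simp: Prf_def sat_Derivation extensional_proof_step)
qed

lemma sat_Prov: "sat e (Prov x) \<longleftrightarrow> (\<exists>p. ev e x = gn p \<and> \<turnstile> p)"
proof
  assume "sat e (Prov x)"
  then show "\<exists>p. ev e x = gn p \<and> \<turnstile> p"
    by (auto simp: Prov_def sat_Prf dest: proof_sound)
next
  assume "\<exists>p. ev e x = gn p \<and> \<turnstile> p"
  then obtain p where p: "ev e x = gn p" "\<turnstile> p"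
    by blast
  \<comment> \<open>One sufficiently large \<open>w\<close> is enough: paired with the sequence and
    the number of its last line, it forms the code of a proof.\<close>
  obtain w where "derivable proof_step w (gn p)"
    using eventually_happens[OF generated_derivable[OF generated_proof[OF p(2)]]] by auto
  then show "sat e (Prov x)"
    unfolding derivable_def by (auto simp: Prov_def sat_Prf p)
qed

lemma sat_ProvNegDot: "sat e (ProvNegDot p z) \<longleftrightarrow> \<turnstile> Neg (subst 0 (num (ev e z)) p)"
proof
  assume "sat e (ProvNegDot p z)"
  then show "\<turnstile> Neg (subst 0 (num (ev e z)) p)"
    by (auto simp: ProvNegDot_def sat_Prov subst_rel_npair dest!: num_sound subst_sound)
next
  assume "\<turnstile> Neg (subst 0 (num (ev e z)) p)"
  \<comment> \<open>\<open>ProvNegDot\<close> uses a single bound for both computations; each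
    succeeds for all large \<open>w\<close>, so some \<open>w\<close> serves both.\<close>
  moreover have "\<exists>w. derivable num_step w (npair (ev e z) (gn_trm (num (ev e z)))) \<and>
      derivable subst_step w (npair 0 (npair (gn_trm (num (ev e z)))
        (npair (gn p) (gn (subst 0 (num (ev e z)) p)))))"
    by (rule eventually_happens[OF eventually_conj[OF num_complete subst_complete], simplified])
  ultimately show "sat e (ProvNegDot p z)"
    by (simp add: ProvNegDot_def sat_Prov) metis
qed

theorem theorem7:
  fixes P :: fm
  assumes "PA_consistent"
    and "PA_omega_consistent"
    and "fv P = {0}"
    and "\<turnstile> P \<^bold>\<longleftrightarrow> Exists (ProvNegDot P (Var 0))"
  shows "\<forall>k. undecidable (subst 0 (num k) P)"
proof
  fix k
  \<comment> \<open>The right-hand side does not mention \<open>e\<close>. Hence \<open>P\<close>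
    has the same truth value in every environment, and all its numeral instances are true together
    or false together.\<close>
  have P: "sat e P \<longleftrightarrow> (\<exists>n. \<turnstile> Neg (subst 0 (num n) P))" for e
    using soundness[OF assms(4), of e] by (simp add: sat_ProvNegDot)
  have not_provable_neg: "\<not> \<turnstile> Neg (subst 0 (num n) P)" for n
    using soundness[of "Neg (subst 0 (num n) P)" "\<lambda>_. 0"] by (auto simp: sat_subst P)
  then have "\<not> \<turnstile> subst 0 (num k) P"
    using soundness[of "subst 0 (num k) P" "\<lambda>_. 0"] by (auto simp: sat_subst P)
  with not_provable_neg show "undecidable (subst 0 (num k) P)"
    by (simp add: undecidable_def refutable_def)
qed

end
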